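(* Let $n\in\mathbb{N}$ with $n\ge 2$, let $J\subset\mathcal{Z}_n$ with $s:=|J|$ satisfying $0<s<n$, and consider the polynomial $$\mathcal{Q}(z):=\sum_{j=0}^{n-1}\mathcal{H}_j(J)\,z^{j}.$$ Then: (1) $\deg \mathcal{Q}(z)=n-s$. (2) $\{x\in\mathbb{C}:\ \mathcal{Q}(x)=0\}=\overline{\mathcal{Z}_n\setminus J}=\{\overline{x}\in\mathbb{C}:\ x\in\mathcal{Z}_n\setminus J\}$.
   Context: $\mathbb{N}=\{1,2,\ldots\}$. $\zeta_n:=e^{2\pi i/n}$ and $\mathcal{Z}_n:=\{1,\zeta_n,\ldots,\zeta_n^{n-1}\}$ is the set of $n$th roots of unity in $\mathbb{C}$. $\overline{x}$ denotes the complex conjugate of $x$, and $\overline{A}:=\{\overline{x}:x\in A\}$ for $A\subseteq\mathbb{C}$. For a finite nonempty set $J=\{z_1,\ldots,z_s\}$ of complex numbers, the complete homogeneous symmetric polynomials are $\mathcal{H}_0(J):=1$ and $\mathcal{H}_m(J):=\sum_{1\le j_1\le\cdots\le j_m\le s}z_{j_1}\cdots z_{j_m}$ for $m\ge1$. *)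

theory Defs
  imports Complex_Main "HOL-Library.Multiset" "HOL-Computational_Algebra.Polynomial"
begin

definition zeta :: "nat \<Rightarrow> complex" where
  "zeta n = exp (2 * complex_of_real pi * \<i> / of_nat n)"

definition roots_of_unity :: "nat \<Rightarrow> complex set" where
  "roots_of_unity n = {zeta n ^ k | k. k < n}"

(* The index tuples 1 <= j_1 <= ... <= j_m <= s select m elements of J = {z_1, ..., z_s} with
   repetition and without order, i.e. the multisets of size m over J. The lemma below
   proves the agreement with the indexed sum for every enumeration of J; both are 1 for m = 0.
   For infinite J the value is meaningless. *)
definition complete_hom_sym :: "nat \<Rightarrow> 'a :: comm_semiring_1 set \<Rightarrow> 'a" where
  "complete_hom_sym m J = (\<Sum>X\<in>multisets_of_size J m. prod_mset X)"

lemma complete_hom_sym_enum: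
  fixes z :: "nat \<Rightarrow> 'a :: comm_semiring_1"
  assumes z: "bij_betw z {1..s} J"
  shows "complete_hom_sym m J =
    (\<Sum>js | length js = m \<and> sorted js \<and> set js \<subseteq> {1..s}. \<Prod>j\<leftarrow>js. z j)"
proof -
  define y where "y = inv_into {1..s} z"
  have yz: "y (z j) = j" if "j \<in> {1..s}" for j
    using that z unfolding y_def by (meson bij_betw_inv_into_left)
  have zy: "z (y x) = x" "y x \<in> {1..s}" if "x \<in> J" for x
    using that z unfolding y_def
    by (meson bij_betw_inv_into_right, metis bij_betw_imp_surj_on inv_into_into)
  have zJ: "z j \<in> J" if "j \<in> {1..s}" for j
    using that z by (meson bij_betwE)
  show ?thesis
    unfolding complete_hom_sym_def
  proof (rule sum.reindex_bij_witness[where i = "\<lambda>js. mset (map z js)"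
        and j = "\<lambda>X. sorted_list_of_multiset (image_mset y X)"])
    fix X assume "X \<in> multisets_of_size J m"
    then have X: "set_mset X \<subseteq> J" "size X = m"
      by (auto simp: multisets_of_size_def)
    let ?js = "sorted_list_of_multiset (image_mset y X)"
    have "image_mset z (image_mset y X) = image_mset id X"
      unfolding image_mset.compositionality using X zy by (intro image_mset_cong) auto
    then show mset_js: "mset (map z ?js) = X" by simp
    have "length ?js = m"
      using X by (metis mset_sorted_list_of_multiset size_image_mset size_mset)
    moreover have "set ?js \<subseteq> {1..s}"
      using X zy by auto
    ultimately show "?js \<in> {js. length js = m \<and> sorted js \<and> set js \<subseteq> {1..s}}"
      by simp
    show "(\<Prod>j\<leftarrow>?js. z j) = prod_mset X"
      by (metis mset_js prod_mset_prod_list)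
  next
    fix js assume "js \<in> {js. length js = m \<and> sorted js \<and> set js \<subseteq> {1..s}}"
    then have js: "length js = m" "sorted js" "set js \<subseteq> {1..s}" by auto
    have "map y (map z js) = js"
      using js yz unfolding map_map by (intro map_idI) auto
    then have "image_mset y (mset (map z js)) = mset js"
      by (metis mset_map)
    then show "sorted_list_of_multiset (image_mset y (mset (map z js))) = js"
      using js by (metis sorted_list_of_multiset_mset sorted_sort_id)
    show "mset (map z js) \<in> multisets_of_size J m"
      using js zJ by (auto simp: multisets_of_size_def)
  qed
qed

definition Q_poly :: "nat \<Rightarrow> complex set \<Rightarrow> complex poly" where
  "Q_poly n J = (\<Sum>j<n. monom (complete_hom_sym j J) j)"

end

theory Submission
  imports Defs "HOL-Computational_Algebra.Polynomial_FPS"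
begin

text \<open>
  The power series \<open>F = (\<Sum>m. H\<^sub>m(J) X\<^sup>m)\<close> is the inverse of \<open>\<Prod>z\<in>J. (1 - z X)\<close>. Since the product
  of \<open>1 - z X\<close> over all \<open>n\<close>-th roots of unity \<open>z\<close> is \<open>1 - X\<^sup>n\<close>, the series \<open>F * (1 - X\<^sup>n)\<close> is the
  product of \<open>1 - z X\<close> over the roots of unity outside \<open>J\<close>. It agrees with \<open>F\<close> below degree
  \<open>n\<close>, and it has degree \<open>n - card J < n\<close>, so it is \<open>Q\<close>.
\<close>

text \<open>Split on whether \<open>a\<close> occurs; if it does, removing one copy leaves a
  multiset that may still contain \<open>a\<close>.\<close>

lemma multisets_of_size_insert_Suc:
  "multisets_of_size (insert a A) (Suc m) =
     multisets_of_size A (Suc m) \<union> add_mset a ` multisets_of_size (insert a A) m"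
proof (intro equalityI subsetI)
  fix X assume X: "X \<in> multisets_of_size (insert a A) (Suc m)"
  show "X \<in> multisets_of_size A (Suc m) \<union> add_mset a ` multisets_of_size (insert a A) m"
  proof (cases "a \<in># X")
    case True
    then obtain Y where "X = add_mset a Y" by (rule mset_add)
    with X show ?thesis by (auto simp: multisets_of_size_def)
  next
    case False
    with X show ?thesis by (auto simp: multisets_of_size_def)
  qed
qed (auto simp: multisets_of_size_def)

lemma complete_hom_sym_0 [simp]: "complete_hom_sym 0 J = 1"
  by (simp add: complete_hom_sym_def)

lemma complete_hom_sym_empty: "m > 0 \<Longrightarrow> complete_hom_sym m {} = 0"
  by (simp add: complete_hom_sym_def)

text \<open>This is the coefficient form of the fact that multiplying by \<open>1 - a X\<close>
  turns the generating series of \<open>insert a J\<close> into that of \<open>J\<close>. Since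
  \<open>a \<notin> J\<close>, the two classes of multisets are disjoint.\<close>

lemma complete_hom_sym_insert_Suc:
  assumes "finite J" "a \<notin> J"
  shows "complete_hom_sym (Suc m) (insert a J) =
    complete_hom_sym (Suc m) J + a * complete_hom_sym m (insert a J)"
proof -
  have "complete_hom_sym (Suc m) (insert a J) = complete_hom_sym (Suc m) J +
      (\<Sum>X\<in>add_mset a ` multisets_of_size (insert a J) m. prod_mset X)"
    unfolding complete_hom_sym_def multisets_of_size_insert_Suc
    using assms by (intro sum.union_disjoint finite_imageI finite_multisets_of_size)
      (auto simp: multisets_of_size_def)
  also have "(\<Sum>X\<in>add_mset a ` multisets_of_size (insert a J) m. prod_mset X) =
      a * complete_hom_sym m (insert a J)"
    by (simp add: complete_hom_sym_def sum.reindex inj_on_def sum_distrib_left)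
  finally show ?thesis .
qed

lemma complete_hom_sym_generating_function:
  fixes J :: "'a :: comm_ring_1 set"
  assumes "finite J"
  shows "Abs_fps (\<lambda>m. complete_hom_sym m J) * fps_of_poly (\<Prod>z\<in>J. [:1, -z:]) = 1"
  using assms
proof (induction J)
  case empty
  show ?case by (simp add: fps_eq_iff complete_hom_sym_empty)
next
  case (insert a J)
  let ?F = "\<lambda>J. Abs_fps (\<lambda>m. complete_hom_sym m J)"
  have "?F (insert a J) * fps_of_poly [:1, -a:] = ?F J"
  proof (rule fps_ext)
    fix m
    have "?F (insert a J) * fps_of_poly [:1, -a:] =
        ?F (insert a J) - fps_const a * (fps_X * ?F (insert a J))"
      by (simp add: fps_of_poly_pCons algebra_simps flip: fps_const_neg)
    then show "fps_nth (?F (insert a J) * fps_of_poly [:1, -a:]) m = fps_nth (?F J) m"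
      using insert.hyps
      by (cases m) (simp_all add: complete_hom_sym_insert_Suc)
  qed
  \<comment> \<open>The factor for \<open>a\<close> is absorbed first; what remains is the induction
    hypothesis. The linear factors must stay unexpanded for this regrouping.\<close>
  then show ?case
    using insert by (simp add: fps_of_poly_mult del: mult_pCons_left flip: mult.assoc)
qed

lemma roots_of_unity_eq:
  assumes "n > 0"
  shows "roots_of_unity n = {z. z ^ n = 1}"
proof -
  have "zeta n ^ k = cis (2 * pi * real k / real n)" for k
    by (simp add: zeta_def cis_conv_exp mult_ac flip: exp_of_nat_mult)
  then show ?thesis
    using bij_betw_imp_surj_on[OF bij_betw_roots_unity[OF assms]]
    by (auto simp: roots_of_unity_def)
qed

text \<open>Roots of unity have modulus 1. This is the source of the conjugates: the factor
  \<open>1 - z X\<close> vanishes at \<open>inverse z\<close>.\<close>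

lemma inverse_root_of_unity:
  assumes "z ^ n = (1 :: complex)" "n > 0"
  shows "inverse z = cnj z"
proof -
  have "norm z = 1"
    using assms power_eq_imp_eq_base[of "norm z" n 1] by (simp flip: norm_power)
  then show ?thesis by (simp add: inverse_complex_def complex_div_cnj complex_eq_iff cmod_def)
qed

text \<open>Each factor is truly linear, since only \<open>z = 0\<close> would make it
  constant.\<close>

lemma degree_prod_one_minus:
  fixes A :: "'a :: idom set"
  assumes "0 \<notin> A"
  shows "degree (\<Prod>z\<in>A. [:1, -z:]) = card A"
proof -
  have "degree (\<Prod>z\<in>A. [:1, -z:]) = (\<Sum>z\<in>A. degree [:1, -z:])"
    by (rule degree_prod_sum_eq) auto
  also have "\<dots> = (\<Sum>z\<in>A. 1)"
    using assms by (intro sum.cong) auto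
  finally show ?thesis by simp
qed

text \<open>Both sides have degree at most \<open>n\<close> and agree at \<open>n + 1\<close>
  points: they vanish at the \<open>n\<close> roots of unity and equal 1 at 0.\<close>

lemma prod_one_minus_roots_unity:
  assumes "n > 0"
  shows "(\<Prod>z | z ^ n = (1 :: complex). [:1, -z:]) = 1 - monom 1 n"
proof (rule poly_eqI_degree[where A = "insert 0 {z. z ^ n = 1}"])
  let ?Z = "{z :: complex. z ^ n = 1}"
  have fin: "finite ?Z" using assms by (simp add: finite_roots_unity)
  fix x :: complex assume "x \<in> insert 0 ?Z"
  then consider "x = 0" | "x ^ n = 1" by auto
  then show "poly (\<Prod>z\<in>?Z. [:1, -z:]) x = poly (1 - monom 1 n) x"
  proof cases
    case 1
    then show ?thesis using assms by (simp add: poly_prod poly_monom)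
  next
    case 2
    then have "x \<noteq> 0" using assms by (auto simp: power_0_left)
    moreover have "inverse x \<in> ?Z" using 2 by (simp add: power_inverse)
    \<comment> \<open>The factor vanishing at \<open>x\<close> belongs to \<open>inverse x\<close>,
      again a root of unity.\<close>
    ultimately have "\<exists>z\<in>?Z. 1 - x * z = 0" by (intro bexI[of _ "inverse x"]) auto
    with fin 2 show ?thesis by (simp add: poly_prod poly_monom)
  qed
next
  let ?Z = "{z :: complex. z ^ n = 1}"
  have card: "card (insert 0 ?Z) = Suc n"
    using assms by (simp add: finite_roots_unity card_roots_unity_eq power_0_left)
  have "degree (\<Prod>z\<in>?Z. [:1, -z:]) = n"
    using assms by (subst degree_prod_one_minus) (simp_all add: card_roots_unity_eq power_0_left)
  with card show "degree (\<Prod>z\<in>?Z. [:1, -z:]) < card (insert 0 ?Z)" by simp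
  have "degree (1 - monom 1 n :: complex poly) \<le> n"
    by (intro degree_diff_le) (simp_all add: degree_monom_le)
  with card show "degree (1 - monom 1 n :: complex poly) < card (insert 0 ?Z)" by simp
qed

lemma Q_poly_eq_prod:
  assumes "n > 0" "J \<subseteq> roots_of_unity n" "J \<noteq> {}"
  shows "Q_poly n J = (\<Prod>z\<in>roots_of_unity n - J. [:1, -z:])"
proof (rule poly_eqI)
  fix j
  let ?Z = "roots_of_unity n"
  let ?F = "Abs_fps (\<lambda>m. complete_hom_sym m J)"
  let ?R = "\<Prod>z\<in>?Z - J. [:1, -z:]"
  have Z: "finite ?Z" "0 \<notin> ?Z" "card ?Z = n"
    using assms by (simp_all add: roots_of_unity_eq finite_roots_unity card_roots_unity_eq power_0_left)
  have J: "finite J" using assms Z finite_subset by blast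
  have "(\<Prod>z\<in>?Z. [:1, -z:]) = 1 - monom 1 n"
    using assms by (simp add: roots_of_unity_eq prod_one_minus_roots_unity)
  then have "(\<Prod>z\<in>J. [:1, -z:]) * ?R = 1 - monom 1 n"
    using prod.subset_diff[OF assms(2) Z(1), of "\<lambda>z. [:1, -z:]"] by (simp add: mult.commute)
  then have "?F * fps_of_poly (\<Prod>z\<in>J. [:1, -z:]) * fps_of_poly ?R = ?F * (1 - fps_X ^ n)"
    by (simp add: mult.assoc fps_of_poly_diff fps_of_poly_monom' flip: fps_of_poly_mult)
  then have R: "fps_of_poly ?R = ?F * (1 - fps_X ^ n)"
    by (simp only: complete_hom_sym_generating_function[OF J] mult_1_left)
  show "coeff (Q_poly n J) j = coeff ?R j"
  proof (cases "j < n")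
    case True
    \<comment> \<open>The term \<open>?F * fps_X ^ n\<close> contributes only from degree
      \<open>n\<close> on.\<close>
    then have "coeff ?R j = complete_hom_sym j J"
      using arg_cong[OF R, of "\<lambda>f. fps_nth f j"] by (simp add: right_diff_distrib fps_X_power_mult_right_nth)
    with True show ?thesis
      by (simp add: Q_poly_def coeff_sum)
  next
    case False
    \<comment> \<open>As \<open>J\<close> is nonempty, its complement has fewer than
      \<open>n\<close> elements, so both sides have coefficient 0 from \<open>n\<close> on.\<close>
    have "degree ?R = card (?Z - J)" using Z by (intro degree_prod_one_minus) auto
    also have "\<dots> < card ?Z" using Z assms by (intro psubset_card_mono) auto
    finally have "coeff ?R j = 0" using False Z by (intro coeff_eq_0) auto
    with False show ?thesis by (simp add: Q_poly_def coeff_sum)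
  qed
qed

theorem corollary1p2:
  fixes n :: nat and J :: "complex set"
  assumes "n \<ge> 2"
    and "J \<subseteq> roots_of_unity n"
    and "0 < card J" and "card J < n"
  shows "degree (Q_poly n J) = n - card J
    \<and> {x :: complex. poly (Q_poly n J) x = 0} = cnj ` (roots_of_unity n - J)"
proof
  let ?Z = "roots_of_unity n"
  have n: "n > 0" using assms by simp
  have Z: "finite ?Z" "0 \<notin> ?Z" "card ?Z = n"
    using n by (simp_all add: roots_of_unity_eq finite_roots_unity card_roots_unity_eq power_0_left)
  have Q: "Q_poly n J = (\<Prod>z\<in>?Z - J. [:1, -z:])"
    using assms n by (intro Q_poly_eq_prod) auto
  show "degree (Q_poly n J) = n - card J"
    using Z assms by (simp add: Q degree_prod_one_minus card_Diff_subset finite_subset)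
  \<comment> \<open>Each linear factor has the single zero \<open>inverse z\<close>, which is
    \<open>cnj z\<close> on the unit circle.\<close>
  have "1 - x * z = 0 \<longleftrightarrow> x = cnj z" if "z \<in> ?Z" for x z
  proof -
    have "inverse z = cnj z" "z \<noteq> 0"
      using that n Z inverse_root_of_unity by (auto simp: roots_of_unity_eq)
    then show ?thesis using inverse_unique[of z x] right_inverse[of z] by (auto simp: mult.commute)
  qed
  then show "{x. poly (Q_poly n J) x = 0} = cnj ` (?Z - J)"
    using Z by (auto simp: Q poly_prod)
qed

end
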